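(* Let $K:\mathbb{R}^2\to[0,+\infty[$ and $G:[0,+\infty[\to[0,+\infty[$ satisfy the general conditions stated in the context, and consider collocation with $m=1$ and collocation parameter $0<c_1\le1$. Then there is existence near zero if and only if $\frac{G(y)}{y}$ is unbounded (in $]0,+\infty[$).
   Context: General conditions. The kernel $K:\mathbb{R}^2\to[0,+\infty[$ has its support in $\{(t,s):0\le s\le t\}$; for every $t>0$ the map $s\mapsto K(t,s)$ is locally integrable; $\mathcal K(t):=\int_0^tK(t,s)\,\mathrm{d}s$ is a strictly increasing function; and $\lim_{t\to a^+}\int_a^tK(t,s)\,\mathrm{d}s=0$ for all $a\ge 0$. The nonlinearity $G:[0,+\infty[\to[0,+\infty[$ is continuous, strictly increasing, and $G(0)=0$. Collocation solutions (of the equation $z(t)=G\big(\int_0^tK(t,s)z(s)\,\mathrm{d}s\big)$) for $m=1$. Given $0<c_1\le1$ and a mesh $0=t_0<t_1<\dots<t_N$, put $h_n:=t_{n+1}-t_n$ and $t_{n,1}:=t_n+c_1h_n$. A collocation solution $z_h$ in $[0,t_N]$ is a piecewise constant function, $z_h(t)=Z_{n,1}$ for $t\in\,]t_n,t_{n+1}]$, such that for $n=0,\dots,N-1$ $$Z_{n,1}=G\big(F_n(t_{n,1})+h_nB_nZ_{n,1}\big),\qquad B_n:=\int_0^{c_1}K(t_{n,1},t_n+sh_n)\,\mathrm{d}s,\qquad F_n(t):=\int_0^{t_n}K(t,s)z_h(s)\,\mathrm{d}s .$$ It is nontrivial if it is not identically zero in $]t_0,t_1]$. Existence near zero. There is existence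 near zero if there exists $H_0>0$ such that if $0<h_0\le H_0$ then there are nontrivial collocation solutions in $[0,t_1]$; and moreover, for $n\ge1$ and given $h_0,\dots,h_{n-1}>0$ such that there are nontrivial collocation solutions in $[0,t_n]$, there exists $H_n>0$ (depending in general on $h_0,\dots,h_{n-1}$) such that if $0<h_n\le H_n$ then there are nontrivial collocation solutions in $[0,t_{n+1}]$. *)

theory Defs
  imports "HOL-Analysis.Analysis"
begin

definition locally_integrable :: "(real \<Rightarrow> real) \<Rightarrow> bool" where
  "locally_integrable f \<longleftrightarrow> (\<forall>C. compact C \<longrightarrow> set_integrable lebesgue C f)"

text \<open>
  Since the kernel vanishes off \<open>0 \<le> s \<le> t\<close>, its primitive is zero on the negative axis;
  strict monotonicity is therefore meant on \<open>[0, \<infinity>)\<close>.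
\<close>

definition kernel_conditions :: "(real \<Rightarrow> real \<Rightarrow> real) \<Rightarrow> bool" where
  "kernel_conditions K \<longleftrightarrow>
     (\<forall>t s. 0 \<le> K t s) \<and>
     (\<forall>t s. K t s \<noteq> 0 \<longrightarrow> 0 \<le> s \<and> s \<le> t) \<and>
     (\<forall>t>0. locally_integrable (K t)) \<and>
     strict_mono_on {0..} (\<lambda>t. LINT s:{0..t}|lebesgue. K t s) \<and>
     (\<forall>a\<ge>0. ((\<lambda>t. LINT s:{a..t}|lebesgue. K t s) \<longlongrightarrow> 0) (at_right a))"

text \<open>The nonlinearity is a function on \<open>[0, \<infinity>)\<close>; its values at negative arguments are junk.\<close>

definition nonlinearity_conditions :: "(real \<Rightarrow> real) \<Rightarrow> bool" where
  "nonlinearity_conditions G \<longleftrightarrow>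
     G \<in> {0..} \<rightarrow> {0..} \<and> continuous_on {0..} G \<and> strict_mono_on {0..} G \<and> G 0 = 0"

definition is_mesh :: "(nat \<Rightarrow> real) \<Rightarrow> nat \<Rightarrow> bool" where
  "is_mesh t N \<longleftrightarrow> t 0 = 0 \<and> (\<forall>n<N. t n < t (Suc n))"

definition mesh_step :: "(nat \<Rightarrow> real) \<Rightarrow> nat \<Rightarrow> real" where
  "mesh_step t n = t (Suc n) - t n"

definition collocation_point :: "real \<Rightarrow> (nat \<Rightarrow> real) \<Rightarrow> nat \<Rightarrow> real" where
  "collocation_point c t n = t n + c * mesh_step t n"

definition colloc_B :: "(real \<Rightarrow> real \<Rightarrow> real) \<Rightarrow> real \<Rightarrow> (nat \<Rightarrow> real) \<Rightarrow> nat \<Rightarrow> real" where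
  "colloc_B K c t n =
     (LINT s:{0..c}|lebesgue. K (collocation_point c t n) (t n + s * mesh_step t n))"

definition lag_term ::
    "(real \<Rightarrow> real \<Rightarrow> real) \<Rightarrow> (nat \<Rightarrow> real) \<Rightarrow> (real \<Rightarrow> real) \<Rightarrow> nat \<Rightarrow> real \<Rightarrow> real" where
  "lag_term K t z n x = (LINT s:{0..t n}|lebesgue. K x s * z s)"

text \<open>
  Collocation solutions on \<open>[0, t N]\<close> with one collocation parameter \<open>c\<close>. The condition
  \<open>0 \<le> y\<close> says that \<open>G\<close> is evaluated inside its domain. As \<open>z\<close> is prescribed only on the
  intervals \<open>(t n, t (n + 1)]\<close>, the value \<open>z 0\<close> is irrelevant.
\<close>

definition collocation_solution ::
    "(real \<Rightarrow> real \<Rightarrow> real) \<Rightarrow> (real \<Rightarrow> real) \<Rightarrow> real \<Rightarrow> (nat \<Rightarrow> real) \<Rightarrow> nat \<Rightarrow> (real \<Rightarrow> real) \<Rightarrow> bool"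
  where
  "collocation_solution K G c t N z \<longleftrightarrow>
     is_mesh t N \<and>
     (\<exists>Z. \<forall>n<N.
        (\<forall>x\<in>{t n<..t (Suc n)}. z x = Z n) \<and>
        (let y = lag_term K t z n (collocation_point c t n) + mesh_step t n * colloc_B K c t n * Z n
         in 0 \<le> y \<and> Z n = G y))"

definition nontrivial_collocation_solution ::
    "(real \<Rightarrow> real \<Rightarrow> real) \<Rightarrow> (real \<Rightarrow> real) \<Rightarrow> real \<Rightarrow> (nat \<Rightarrow> real) \<Rightarrow> nat \<Rightarrow> (real \<Rightarrow> real) \<Rightarrow> bool"
  where
  "nontrivial_collocation_solution K G c t N z \<longleftrightarrow>
     collocation_solution K G c t N z \<and> (\<exists>x\<in>{t 0<..t 1}. z x \<noteq> 0)"

definition mesh_of_steps :: "(nat \<Rightarrow> real) \<Rightarrow> nat \<Rightarrow> real" where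
  "mesh_of_steps h n = (\<Sum>i<n. h i)"

text \<open>
  In both clauses only finitely many entries of the step sequence \<open>h\<close> matter: \<open>h 0\<close> in the
  first one, and \<open>h 0, \<dots>, h (n - 1)\<close> (extended by the new step \<open>x\<close>) in the second one.
\<close>

definition existence_near_zero ::
    "(real \<Rightarrow> real \<Rightarrow> real) \<Rightarrow> (real \<Rightarrow> real) \<Rightarrow> real \<Rightarrow> bool" where
  "existence_near_zero K G c \<longleftrightarrow>
     (\<exists>H>0. \<forall>h. 0 < h 0 \<and> h 0 \<le> H \<longrightarrow>
        (\<exists>z. nontrivial_collocation_solution K G c (mesh_of_steps h) 1 z)) \<and>
     (\<forall>n\<ge>1. \<forall>h. (\<forall>i<n. 0 < h i) \<and>
        (\<exists>z. nontrivial_collocation_solution K G c (mesh_of_steps h) n z) \<longrightarrow>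
        (\<exists>H>0. \<forall>x. 0 < x \<and> x \<le> H \<longrightarrow>
           (\<exists>z. nontrivial_collocation_solution K G c (mesh_of_steps (h(n := x))) (Suc n) z)))"

end

theory Submission
  imports Defs
begin

text \<open>
  Put \<open>p = t n + c * h n\<close> and \<open>b = (LINT s:{t n..p}|lebesgue. K p s)\<close>. The collocation equation
  reads \<open>Z = G (a + b * Z)\<close> with \<open>a\<close> the lag term, and \<open>b\<close> tends to \<open>0\<close> with the step \<open>h n\<close>.
  For \<open>n = 0\<close> the lag term vanishes, and nonzero solutions correspond, through \<open>y = b * Z\<close>, to
  points where \<open>G y / y = 1 / b\<close>; by the intermediate value theorem such points exist for all small
  \<open>b\<close> iff \<open>G y / y\<close> is unbounded. For \<open>n \<ge> 1\<close> the lag term stays bounded as \<open>h n\<close> shrinks, so the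
  intermediate value theorem always yields a solution: the second half of existence near zero
  holds for every nonlinearity.
\<close>

section \<open>Kernel integrals and lag terms\<close>

definition kernel_mass :: "(real \<Rightarrow> real \<Rightarrow> real) \<Rightarrow> real \<Rightarrow> real \<Rightarrow> real" where
  "kernel_mass K a t = (LINT s:{a..t}|lebesgue. K t s)"

lemma lag_term_0:
  assumes "t 0 = 0"
  shows "lag_term K t z 0 x = 0"
proof -
  \<comment> \<open>The domain of integration is the single point 0, a null set, so the unspecified
    value \<open>z 0\<close> cannot contribute.\<close>
  have "AE s in lebesgue. s \<noteq> (0::real)"
    by (rule AE_completion) (rule AE_lborel_singleton)
  then have "AE s in lebesgue. indicator {0..t 0} s *\<^sub>R (K x s * z s) = 0"
    by (rule eventually_mono) (simp add: assms indicator_def)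
  then show ?thesis
    unfolding lag_term_def set_lebesgue_integral_def by (rule integral_eq_zero_AE)
qed

context
  fixes K :: "real \<Rightarrow> real \<Rightarrow> real"
  assumes K: "kernel_conditions K"
begin

lemma kernel_nonneg: "0 \<le> K t s"
  using K by (simp add: kernel_conditions_def)

lemma kernel_set_integrable: "0 < t \<Longrightarrow> compact C \<Longrightarrow> set_integrable lebesgue C (K t)"
  using K by (simp add: kernel_conditions_def locally_integrable_def)

lemma kernel_mass_nonneg: "0 \<le> kernel_mass K a t"
  unfolding kernel_mass_def set_lebesgue_integral_def
  by (rule integral_nonneg_AE) (simp add: kernel_nonneg)

lemma kernel_mass_strict_mono: "0 \<le> s \<Longrightarrow> s < t \<Longrightarrow> kernel_mass K 0 s < kernel_mass K 0 t"
  using K by (auto simp: kernel_conditions_def kernel_mass_def strict_mono_on_def)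

lemma kernel_mass_pos: "0 < t \<Longrightarrow> 0 < kernel_mass K 0 t"
  using kernel_mass_strict_mono[of 0 t] kernel_mass_nonneg[of 0 0] by simp

lemma kernel_mass_small:
  assumes "0 \<le> a" "0 < e"
  obtains d where "0 < d" "\<And>x. 0 < x \<Longrightarrow> x \<le> d \<Longrightarrow> kernel_mass K a (a + x) < e"
proof -
  have "(kernel_mass K a \<longlongrightarrow> 0) (at_right a)"
    using K assms(1) unfolding kernel_conditions_def kernel_mass_def by blast
  then have "eventually (\<lambda>t. kernel_mass K a t < e) (at_right a)"
    using assms(2) by (rule order_tendstoD)
  then obtain u where "a < u" "\<And>t. a < t \<Longrightarrow> t < u \<Longrightarrow> kernel_mass K a t < e"
    by (auto simp: eventually_at_right_field)
  then show thesis
    \<comment> \<open>Halving the gap turns the open bound \<open>t < u\<close> into the closed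
      bound \<open>x \<le> d\<close>.\<close>
    by (intro that[of "(u - a) / 2"]) (auto simp: field_simps)
qed

text \<open>The substitution \<open>s \<mapsto> t n + s * h\<close> with
  \<open>h = mesh_step t n\<close> maps \<open>{0..c}\<close> onto the interval from
  \<open>t n\<close> to the collocation point; its derivative \<open>h\<close> is the factor in
  front of \<open>colloc_B\<close>.\<close>

lemma mesh_step_colloc_B:
  assumes "0 \<le> t n" "0 < mesh_step t n" "0 < c"
  shows "mesh_step t n * colloc_B K c t n = kernel_mass K (t n) (collocation_point c t n)"
proof -
  define p where "p = collocation_point c t n"
  define h where "h = mesh_step t n"
  define g where "g = (\<lambda>s. t n + s * h)"
  have h: "0 < h" using assms by (simp add: h_def)
  have p: "p = t n + c * h" by (simp add: p_def h_def collocation_point_def)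
  \<comment> \<open>Local integrability of \<open>K p\<close> is assumed only for positive
    \<open>p\<close>.\<close>
  have "0 < p" using assms h by (simp add: p add_nonneg_pos)
  have img: "g ` {0..c} = {t n..p}"
    using h image_affinity_atLeastAtMost[of h "t n" 0 c] assms(3)
    by (simp add: g_def p mult.commute add.commute)
  have int: "K p absolutely_integrable_on {t n..p}"
    using \<open>0 < p\<close> by (intro kernel_set_integrable) auto
  have "(g has_vector_derivative h) (at x within {0..c})" for x
    unfolding g_def has_real_derivative_iff_has_vector_derivative[symmetric]
    by (auto intro!: derivative_eq_intros)
  moreover have "inj_on g {0..c}" using h by (auto simp: g_def inj_on_def)
  ultimately have "(\<lambda>s. \<bar>h\<bar> * K p (g s)) absolutely_integrable_on {0..c} \<and>
      integral {0..c} (\<lambda>s. \<bar>h\<bar> * K p (g s)) = integral {t n..p} (K p)"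
    using has_absolute_integral_change_of_variables_1'[of "{0..c}" g "\<lambda>_. h" "K p"
        "integral {t n..p} (K p)"] int img
    by (simp add: has_real_derivative_iff_has_vector_derivative)
  then have "(LINT s:{0..c}|lebesgue. h * K p (g s)) = (LINT s:{t n..p}|lebesgue. K p s)"
    using h int by (simp add: set_lebesgue_integral_eq_integral)
  then show ?thesis
    by (simp add: colloc_B_def kernel_mass_def p_def h_def g_def)
qed

lemma lag_term_nonneg:
  assumes "\<And>s. 0 < s \<Longrightarrow> s \<le> t n \<Longrightarrow> 0 \<le> z s"
  shows "0 \<le> lag_term K t z n x"
proof -
  have "AE s in lebesgue. s \<noteq> (0::real)"
    by (rule AE_completion) (rule AE_lborel_singleton)
  then show ?thesis
    unfolding lag_term_def set_lebesgue_integral_def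
    by (intro integral_nonneg_AE)
      (use assms kernel_nonneg in \<open>auto simp: indicator_def elim!: eventually_mono\<close>)
qed

text \<open>Since the kernel is nonnegative, the domain can be enlarged from \<open>{0..t n}\<close>
  to \<open>{0..x}\<close>. This makes the bound a multiple of \<open>kernel_mass K 0 x\<close>,
  which is monotone in \<open>x\<close>.\<close>

lemma lag_term_le:
  assumes "\<And>s. 0 < s \<Longrightarrow> s \<le> t n \<Longrightarrow> z s \<le> M" "0 \<le> M" "0 < x" "t n \<le> x"
  shows "lag_term K t z n x \<le> M * kernel_mass K 0 x"
proof -
  have "AE s in lebesgue. s \<noteq> (0::real)"
    by (rule AE_completion) (rule AE_lborel_singleton)
  then have "AE s in lebesgue. indicator {0..t n} s *\<^sub>R (K x s * z s) \<le>
      M * (indicator {0..x} s *\<^sub>R K x s)"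
  proof (rule eventually_mono)
    fix s :: real assume "s \<noteq> 0"
    show "indicator {0..t n} s *\<^sub>R (K x s * z s) \<le> M * (indicator {0..x} s *\<^sub>R K x s)"
      using assms \<open>s \<noteq> 0\<close> kernel_nonneg[of x s]
        mult_left_mono[of "z s" M "K x s"] by (auto simp: indicator_def mult.commute)
  qed
  moreover have "integrable lebesgue (\<lambda>s. M * (indicator {0..x} s *\<^sub>R K x s))"
    using kernel_set_integrable[OF assms(3), of "{0..x}"]
    by (intro integrable_mult_right) (simp add: set_integrable_def)
  \<comment> \<open>A lag integrand that fails to be integrable has integral 0 by default; the
    comparison covers this case because the dominating function is nonnegative.\<close>
  ultimately have "lag_term K t z n x \<le> (LINT s|lebesgue. M * (indicator {0..x} s *\<^sub>R K x s))"
    unfolding lag_term_def set_lebesgue_integral_def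
    by (intro integral_mono_AE') (use assms(2) kernel_nonneg in \<open>auto intro!: AE_I2\<close>)
  then show ?thesis
    by (simp add: kernel_mass_def set_lebesgue_integral_def)
qed

end

section \<open>Scalar equations for the nonlinearity\<close>

context
  fixes G :: "real \<Rightarrow> real"
  assumes G: "nonlinearity_conditions G"
begin

lemma nonlinearity_mono: "0 \<le> x \<Longrightarrow> x \<le> y \<Longrightarrow> G x \<le> G y"
  using G strict_mono_onD[of "{0..}" G x y]
  by (cases "x = y") (auto simp: nonlinearity_conditions_def)

lemma nonlinearity_nonneg: "0 \<le> x \<Longrightarrow> 0 \<le> G x"
  using G by (auto simp: nonlinearity_conditions_def)

lemma nonlinearity_pos: "0 < x \<Longrightarrow> 0 < G x"
  using G strict_mono_onD[of "{0..}" G 0 x] by (auto simp: nonlinearity_conditions_def)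

text \<open>With \<open>M = G (A + 1)\<close>, the function \<open>Z - G (a + b * Z)\<close> is at
  most 0 at \<open>Z = 0\<close>; at \<open>Z = M\<close> it is at least 0, because
  \<open>b * M \<le> 1\<close> keeps the argument of \<open>G\<close> below \<open>A + 1\<close>.
  The condition on \<open>b\<close> involves only \<open>A\<close>, so it is uniform in
  \<open>a\<close>.\<close>

lemma step_equation_solvable:
  assumes "0 \<le> a" "a \<le> A" "0 \<le> b" "b * G (A + 1) \<le> 1"
  obtains Z where "0 \<le> a + b * Z" "Z = G (a + b * Z)"
proof -
  define M where "M = G (A + 1)"
  have M: "0 \<le> M" using assms by (simp add: M_def nonlinearity_nonneg)
  have "continuous_on {0..} G"
    using G by (simp add: nonlinearity_conditions_def)
  then have "continuous_on {0..M} (\<lambda>Z. G (a + b * Z))"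
    by (rule continuous_on_compose2) (use assms in \<open>auto intro!: continuous_intros\<close>)
  then have "continuous_on {0..M} (\<lambda>Z. Z - G (a + b * Z))"
    by (intro continuous_on_diff continuous_on_id)
  moreover have "G (a + b * M) \<le> M"
    unfolding M_def using assms M by (intro nonlinearity_mono) (auto simp: M_def)
  ultimately obtain Z where "0 \<le> Z" "Z - G (a + b * Z) = 0"
    using IVT'[of "\<lambda>Z. Z - G (a + b * Z)" 0 0 M] assms(1) M nonlinearity_nonneg[of a] by auto
  then show thesis using that[of Z] assms by auto
qed

text \<open>The quotient is continuous on a connected set, so its range is an interval. It contains
  \<open>G 1\<close>, the quotient at 1, and a value above \<open>q\<close>.\<close>

lemma quotient_attains:
  assumes unb: "\<not> bounded ((\<lambda>y. G y / y) ` {0<..})" and "G 1 \<le> q"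
  obtains y where "0 < y" "G y / y = q"
proof -
  let ?I = "(\<lambda>y. G y / y) ` {0<..}"
  obtain w where w: "0 < w" "q < G w / w"
  proof -
    have "\<exists>w>0. q < G w / w"
    proof (rule ccontr)
      assume *: "\<not> ?thesis"
      \<comment> \<open>The quotient is positive, so the upper bound \<open>q\<close> alone bounds
        its absolute value.\<close>
      have "bounded ?I"
        unfolding bounded_iff
        by (intro exI[of _ q]) (use * nonlinearity_pos in \<open>force simp: not_less\<close>)
      then show False using unb by simp
    qed
    then show thesis using that by blast
  qed
  have "connected ?I"
    using G by (intro connected_continuous_image continuous_intros)
      (auto simp: nonlinearity_conditions_def elim: continuous_on_subset)
  moreover have "G 1 \<in> ?I" "G w / w \<in> ?I"
    using w by (auto intro!: image_eqI[of _ _ 1])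
  ultimately have "q \<in> ?I"
    using assms(2) w connectedD_interval[of ?I "G 1" "G w / w" q] by simp
  then show thesis using that by auto
qed

text \<open>On \<open>]0, t n]\<close> the solution takes finitely many values, all nonnegative as
  values of \<open>G\<close>; hence their sum bounds each of them.\<close>

lemma collocation_solution_bounds:
  assumes "collocation_solution K G c t n z"
  obtains M where "0 \<le> M" "\<And>s. 0 < s \<Longrightarrow> s \<le> t n \<Longrightarrow> 0 \<le> z s \<and> z s \<le> M"
proof -
  from assms have t0: "t 0 = 0"
    by (simp add: collocation_solution_def is_mesh_def)
  from assms obtain Z where sol: "\<forall>n'<n. (\<forall>x\<in>{t n'<..t (Suc n')}. z x = Z n') \<and>
      (let y = lag_term K t z n' (collocation_point c t n') + mesh_step t n' * colloc_B K c t n' * Z n'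
       in 0 \<le> y \<and> Z n' = G y)"
    unfolding collocation_solution_def by (elim conjE exE)
  have Z: "z x = Z k" if "k < n" "x \<in> {t k<..t (Suc k)}" for k x
    using sol that by simp
  have Zn: "0 \<le> Z k" if "k < n" for k
    using sol that nonlinearity_nonneg by (metis (lifting))
  have covered: "\<exists>k<m. s \<in> {t k<..t (Suc k)}" if "0 < s" "s \<le> t m" for m s
    using that
  proof (induction m)
    case 0
    then show ?case by (simp add: t0)
  next
    case (Suc m)
    then show ?case by (cases "s \<le> t m") (auto intro: less_SucI)
  qed
  have "0 \<le> z s \<and> z s \<le> (\<Sum>k<n. Z k)" if s: "0 < s" "s \<le> t n" for s
  proof -
    obtain k where k: "k < n" "s \<in> {t k<..t (Suc k)}" using covered[OF s] by blast
    then have "z s = Z k" using Z by blast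
    then show ?thesis using k(1) Zn by (auto intro!: member_le_sum)
  qed
  then show thesis using that[of "\<Sum>k<n. Z k"] Zn by (auto intro!: sum_nonneg)
qed

end

section \<open>Collocation on meshes given by step sequences\<close>

lemma mesh_of_steps_0 [simp]: "mesh_of_steps h 0 = 0"
  by (simp add: mesh_of_steps_def)

lemma mesh_of_steps_Suc [simp]: "mesh_of_steps h (Suc n) = mesh_of_steps h n + h n"
  by (simp add: mesh_of_steps_def)

lemma mesh_step_mesh_of_steps [simp]: "mesh_step (mesh_of_steps h) n = h n"
  by (simp add: mesh_step_def)

lemma mesh_of_steps_upd: "k \<le> n \<Longrightarrow> mesh_of_steps (h(n := x)) k = mesh_of_steps h k"
  by (auto simp: mesh_of_steps_def)

lemma mesh_of_steps_mono:
  "(\<And>i. i < n \<Longrightarrow> 0 < h i) \<Longrightarrow> k \<le> n \<Longrightarrow> mesh_of_steps h k \<le> mesh_of_steps h n"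
  unfolding mesh_of_steps_def by (rule sum_mono2) (auto intro: less_imp_le)

text \<open>Write \<open>b\<close> for the kernel mass. Since \<open>b > 0\<close>, the substitution
  \<open>y = b * Z\<close> matches the nonzero solutions of \<open>Z = G (b * Z)\<close> having
  \<open>b * Z \<ge> 0\<close> with the positive \<open>y\<close> satisfying
  \<open>G y = y / b\<close>.\<close>

lemma nontrivial_first_step_iff:
  assumes K: "kernel_conditions K" and G: "nonlinearity_conditions G"
    and c: "0 < c" and h: "0 < h 0"
  shows "(\<exists>z. nontrivial_collocation_solution K G c (mesh_of_steps h) 1 z) \<longleftrightarrow>
    (\<exists>y>0. G y / y = 1 / kernel_mass K 0 (c * h 0))"
proof -
  let ?t = "mesh_of_steps h" and ?b = "kernel_mass K 0 (c * h 0)"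
  have b: "0 < ?b" using c h by (intro kernel_mass_pos[OF K]) simp
  have B: "h 0 * colloc_B K c ?t 0 = ?b"
    using mesh_step_colloc_B[OF K, of ?t 0 c] c h by (simp add: collocation_point_def)
  have lag: "lag_term K ?t z 0 x = 0" for z x
    by (rule lag_term_0) simp
  have *: "nontrivial_collocation_solution K G c ?t 1 z \<longleftrightarrow>
      (\<exists>Z. (\<forall>x\<in>{0<..h 0}. z x = Z) \<and> 0 \<le> ?b * Z \<and> Z = G (?b * Z)) \<and> (\<exists>x\<in>{0<..h 0}. z x \<noteq> 0)"
    for z
  proof -
    \<comment> \<open>With a single subinterval only \<open>Z 0\<close> enters, so quantifying over
      sequences reduces to quantifying over reals.\<close>
    have "(\<exists>Z::nat \<Rightarrow> real. P (Z 0)) \<longleftrightarrow> (\<exists>Z. P Z)" for P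
      by (auto intro: exI[of "\<lambda>Z. P (Z 0)" "\<lambda>_. _"])
    from this[of "\<lambda>Z. (\<forall>x\<in>{0<..h 0}. z x = Z) \<and> 0 \<le> ?b * Z \<and> Z = G (?b * Z)"]
    show ?thesis
      using h by (simp add: nontrivial_collocation_solution_def collocation_solution_def is_mesh_def
        Let_def lag B)
  qed
  show ?thesis
  proof
    assume "\<exists>z. nontrivial_collocation_solution K G c ?t 1 z"
    then obtain Z where Z: "0 \<le> ?b * Z" "Z = G (?b * Z)" "Z \<noteq> 0"
      unfolding * by auto
    then have "0 < Z" using b by (simp add: zero_le_mult_iff)
    then show "\<exists>y>0. G y / y = 1 / ?b"
      using Z b by (intro exI[of _ "?b * Z"]) auto
  next
    assume "\<exists>y>0. G y / y = 1 / ?b"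
    then obtain y where y: "0 < y" "G y / y = 1 / ?b" by blast
    then have "?b * (y / ?b) = y" "G y = y / ?b" using b by (auto simp: field_simps)
    then show "\<exists>z. nontrivial_collocation_solution K G c ?t 1 z"
      unfolding * using y b h by (intro exI[of _ "\<lambda>_. y / ?b"]) auto
  qed
qed

text \<open>The unknown is the argument \<open>y\<close> of \<open>G\<close> in the new equation,
  and \<open>G y\<close> is the new constant value. The earlier equations survive because mesh
  points up to index \<open>n\<close>, and with them the old lag terms and coefficients, do not see
  the new step.\<close>

lemma collocation_solution_extend:
  assumes K: "kernel_conditions K" and c: "0 < c"
    and h: "\<And>i. i < n \<Longrightarrow> 0 < h i" and x: "0 < x"
    and sol: "collocation_solution K G c (mesh_of_steps h) n z"
    and p: "p = mesh_of_steps h n + c * x"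
    and y: "0 \<le> y" "y = lag_term K (mesh_of_steps h) z n p + kernel_mass K (mesh_of_steps h n) p * G y"
  shows "collocation_solution K G c (mesh_of_steps (h(n := x))) (Suc n)
    (\<lambda>s. if s \<le> mesh_of_steps h n then z s else G y)"
proof -
  let ?t = "mesh_of_steps h" and ?h = "h(n := x)"
  let ?u = "mesh_of_steps ?h" and ?w = "\<lambda>s. if s \<le> mesh_of_steps h n then z s else G y"
  obtain Z where Z: "\<And>k s. k < n \<Longrightarrow> s \<in> {?t k<..?t (Suc k)} \<Longrightarrow> z s = Z k"
    and eq: "\<And>k. k < n \<Longrightarrow>
      0 \<le> lag_term K ?t z k (collocation_point c ?t k) + h k * colloc_B K c ?t k * Z k \<and>
      Z k = G (lag_term K ?t z k (collocation_point c ?t k) + h k * colloc_B K c ?t k * Z k)"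
    using sol by (auto simp: collocation_solution_def Let_def)
  have tn: "?t k \<le> ?t n" if "k \<le> n" for k
    using that h by (intro mesh_of_steps_mono)
  have ut: "?u k = ?t k" if "k \<le> n" for k
    using that by (rule mesh_of_steps_upd)
  \<comment> \<open>The function is changed only to the right of \<open>?t n\<close>. The case
    \<open>k = n\<close> is included, since the new equation has the old solution in its lag
    term.\<close>
  have lag: "lag_term K ?u ?w k q = lag_term K ?t z k q" if "k \<le> n" for k q
    unfolding lag_term_def set_lebesgue_integral_def using tn[OF that] ut[OF that]
    by (intro Bochner_Integration.integral_cong refl) (auto simp: indicator_def)
  have cp: "collocation_point c ?u k = collocation_point c ?t k" if "k < n" for k
    using that by (simp add: collocation_point_def ut)
  have B: "colloc_B K c ?u k = colloc_B K c ?t k" if "k < n" for k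
    using that by (simp add: colloc_B_def cp ut)
  have pn: "collocation_point c ?u n = p"
    by (simp add: collocation_point_def ut p)
  have Bn: "x * colloc_B K c ?u n = kernel_mass K (?t n) p"
    using mesh_step_colloc_B[OF K, of ?u n c] tn[of 0] c x by (simp add: ut pn)
  show ?thesis
    unfolding collocation_solution_def Let_def
  proof (intro conjI exI[of _ "Z(n := G y)"] allI impI ballI)
    show "is_mesh ?u (Suc n)"
      using h x by (auto simp: is_mesh_def less_Suc_eq)
  next
    fix k s assume k: "k < Suc n" and s: "s \<in> {?u k<..?u (Suc k)}"
    show "?w s = (Z(n := G y)) k"
    proof (cases "k = n")
      case True
      then show ?thesis using s by (simp add: ut)
    next
      case False
      then have "k < n" using k by simp
      then show ?thesis
        using s Z[of k s] tn[of "Suc k"] by (simp add: ut)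
    qed
  next
    fix k assume k: "k < Suc n"
    let ?y = "lag_term K ?u ?w k (collocation_point c ?u k) +
      mesh_step ?u k * colloc_B K c ?u k * (Z(n := G y)) k"
    have "0 \<le> ?y \<and> (Z(n := G y)) k = G ?y"
    proof (cases "k = n")
      case True
      have "?y = y" unfolding True using y(2) by (simp add: lag pn Bn)
      then show ?thesis using True y(1) by simp
    next
      case False
      then show ?thesis using k eq[of k] by (simp add: lag cp B)
    qed
    then show "0 \<le> ?y" "(Z(n := G y)) k = G ?y" by blast+
  qed
qed

text \<open>All admissible steps keep the collocation point below
  \<open>mesh_of_steps h n + 1\<close>. Thus one bound \<open>A\<close> on the lag term serves them
  all, and the threshold for the step can be fixed in advance.\<close>

lemma nontrivial_solution_continues:
  assumes K: "kernel_conditions K" and G: "nonlinearity_conditions G"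
    and c: "0 < c" "c \<le> 1" and n: "1 \<le> n" and h: "\<And>i. i < n \<Longrightarrow> 0 < h i"
    and sol: "nontrivial_collocation_solution K G c (mesh_of_steps h) n z"
  shows "\<exists>H>0. \<forall>x. 0 < x \<and> x \<le> H \<longrightarrow>
    (\<exists>z. nontrivial_collocation_solution K G c (mesh_of_steps (h(n := x))) (Suc n) z)"
proof -
  let ?t = "mesh_of_steps h"
  have colloc: "collocation_solution K G c ?t n z"
    using sol by (simp add: nontrivial_collocation_solution_def)
  obtain M where M: "0 \<le> M" "\<And>s. 0 < s \<Longrightarrow> s \<le> ?t n \<Longrightarrow> 0 \<le> z s \<and> z s \<le> M"
    using collocation_solution_bounds[OF G colloc] by blast
  have t1: "?t 1 \<le> ?t n" using n h by (intro mesh_of_steps_mono)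
  have tn: "0 < ?t n" using t1 h[of 0] n by simp
  define A where "A = M * kernel_mass K 0 (?t n + 1)"
  have A: "0 \<le> A" using M(1) kernel_mass_nonneg[OF K] by (simp add: A_def)
  have GA: "0 < G (A + 1)" using A by (intro nonlinearity_pos[OF G]) simp
  obtain d where d: "0 < d"
    "\<And>x. 0 < x \<Longrightarrow> x \<le> d \<Longrightarrow> kernel_mass K (?t n) (?t n + x) < 1 / G (A + 1)"
    using kernel_mass_small[OF K, of "?t n" "1 / G (A + 1)"] tn GA by auto
  \<comment> \<open>The bound \<open>d\<close> makes the kernel mass small enough for the step
    equation; \<open>1 / 2\<close> keeps the collocation point strictly below
    \<open>?t n + 1\<close>.\<close>
  have "\<exists>z. nontrivial_collocation_solution K G c (mesh_of_steps (h(n := x))) (Suc n) z"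
    if x: "0 < x" "x \<le> min d (1 / 2)" for x
  proof -
    define p where "p = ?t n + c * x"
    have "0 < c * x" using c x by simp
    moreover have "c * x \<le> x" using c x by (intro mult_left_le_one_le) auto
    ultimately have cx: "0 < c * x" "c * x \<le> x" .
    have "0 \<le> p" "p < ?t n + 1" using tn x cx unfolding p_def by linarith+
    then have "kernel_mass K 0 p < kernel_mass K 0 (?t n + 1)"
      by (intro kernel_mass_strict_mono[OF K])
    then have "M * kernel_mass K 0 p \<le> A"
      using M(1) by (simp add: A_def mult_left_mono)
    then have lagA: "lag_term K ?t z n p \<le> A"
      using lag_term_le[OF K, of ?t n z M p] M tn cx by (force simp: p_def)
    have lag0: "0 \<le> lag_term K ?t z n p"
      using M by (intro lag_term_nonneg[OF K]) auto
    have "c * x \<le> d" using cx x by linarith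
    then have "kernel_mass K (?t n) p * G (A + 1) \<le> 1"
      using d(2)[OF cx(1)] GA by (simp add: p_def field_simps)
    then obtain Z where Z: "0 \<le> lag_term K ?t z n p + kernel_mass K (?t n) p * Z"
      "Z = G (lag_term K ?t z n p + kernel_mass K (?t n) p * Z)"
      using step_equation_solvable[OF G lag0 lagA kernel_mass_nonneg[OF K]] by blast
    let ?y = "lag_term K ?t z n p + kernel_mass K (?t n) p * Z"
    have y: "?y = lag_term K ?t z n p + kernel_mass K (?t n) p * G ?y"
      using Z(2) by simp
    have "collocation_solution K G c (mesh_of_steps (h(n := x))) (Suc n)
        (\<lambda>s. if s \<le> ?t n then z s else G ?y)"
      by (rule collocation_solution_extend[OF K c(1) h x(1) colloc p_def Z(1) y])
    moreover have "\<exists>s\<in>{?t 0<..?t 1}. z s \<noteq> 0"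
      using sol by (simp add: nontrivial_collocation_solution_def)
    \<comment> \<open>As \<open>?t 1 \<le> ?t n\<close>, the extension leaves the first subinterval
      untouched.\<close>
    then have "\<exists>s\<in>{mesh_of_steps (h(n := x)) 0<..mesh_of_steps (h(n := x)) 1}.
        (if s \<le> ?t n then z s else G ?y) \<noteq> 0"
      using t1 n by (force simp: mesh_of_steps_upd)
    ultimately show ?thesis
      unfolding nontrivial_collocation_solution_def by blast
  qed
  then show ?thesis
    using d(1) by (intro exI[of _ "min d (1 / 2)"]) auto
qed

section \<open>Existence near zero and the growth of \<open>G y / y\<close>\<close>

theorem proposition3p1:
  fixes K :: "real \<Rightarrow> real \<Rightarrow> real" and G :: "real \<Rightarrow> real" and c :: real
  assumes "kernel_conditions K"
    and "nonlinearity_conditions G"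
    and "0 < c" and "c \<le> 1"
  shows "existence_near_zero K G c \<longleftrightarrow> \<not> bounded ((\<lambda>y. G y / y) ` {0<..})"
proof
  assume "existence_near_zero K G c"
  then obtain H where H: "0 < H" "\<And>h. 0 < h 0 \<Longrightarrow> h 0 \<le> H \<Longrightarrow>
      \<exists>z. nontrivial_collocation_solution K G c (mesh_of_steps h) 1 z"
    unfolding existence_near_zero_def by blast
  show "\<not> bounded ((\<lambda>y. G y / y) ` {0<..})"
  proof
    assume "bounded ((\<lambda>y. G y / y) ` {0<..})"
    then obtain Q where Q: "0 < Q" "\<And>y. 0 < y \<Longrightarrow> \<bar>G y / y\<bar> \<le> Q"
      by (auto simp: bounded_pos)
    obtain d where d: "0 < d" "\<And>x. 0 < x \<Longrightarrow> x \<le> d \<Longrightarrow> kernel_mass K 0 (0 + x) < 1 / Q"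
      using kernel_mass_small[OF assms(1), of 0 "1 / Q"] Q(1) by auto
    \<comment> \<open>The bound \<open>H\<close> provides a nontrivial first step, while
      \<open>d\<close> pushes the required quotient \<open>1 / kernel_mass K 0 (c * x)\<close> above
      \<open>Q\<close>.\<close>
    define x where "x = min H d"
    have x: "0 < x" "x \<le> H" "x \<le> d" using H(1) d(1) by (auto simp: x_def)
    have "c * x \<le> x" using assms(3,4) x by (intro mult_left_le_one_le) auto
    moreover have "0 < c * x" using assms(3) x by simp
    ultimately have cx: "0 < c * x" "c * x \<le> d" using x by linarith+
    obtain y where y: "0 < y" "G y / y = 1 / kernel_mass K 0 (c * x)"
      using nontrivial_first_step_iff[OF assms(1-3), of "\<lambda>_. x"] H(2)[of "\<lambda>_. x"] x by auto
    have "Q < 1 / kernel_mass K 0 (c * x)"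
      using d(2)[OF cx] kernel_mass_pos[OF assms(1) cx(1)] Q(1) by (simp add: field_simps)
    then show False using Q(2)[OF y(1)] unfolding y(2) by linarith
  qed
next
  assume unb: "\<not> bounded ((\<lambda>y. G y / y) ` {0<..})"
  have G1: "0 < G 1" by (rule nonlinearity_pos[OF assms(2)]) simp
  \<comment> \<open>Kernel mass below \<open>1 / G 1\<close> makes its reciprocal at least
    \<open>G 1\<close>, the lower bound needed for the quotient to attain it.\<close>
  obtain d where d: "0 < d" "\<And>x. 0 < x \<Longrightarrow> x \<le> d \<Longrightarrow> kernel_mass K 0 (0 + x) < 1 / G 1"
    using kernel_mass_small[OF assms(1), of 0 "1 / G 1"] G1 by auto
  have "\<exists>z. nontrivial_collocation_solution K G c (mesh_of_steps h) 1 z"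
    if h: "0 < h 0" "h 0 \<le> d" for h
  proof -
    have "c * h 0 \<le> h 0" using assms(3,4) h by (intro mult_left_le_one_le) auto
    moreover have "0 < c * h 0" using assms(3) h by simp
    ultimately have ch: "0 < c * h 0" "c * h 0 \<le> d" using h by linarith+
    have "G 1 \<le> 1 / kernel_mass K 0 (c * h 0)"
      using d(2)[OF ch] kernel_mass_pos[OF assms(1) ch(1)] G1 by (simp add: field_simps)
    then show ?thesis
      unfolding nontrivial_first_step_iff[of K G c h, OF assms(1-3) h(1)]
      using quotient_attains[OF assms(2) unb] by metis
  qed
  then show "existence_near_zero K G c"
    unfolding existence_near_zero_def
    using d(1) nontrivial_solution_continues[OF assms] by blast
qed

end
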